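(* Let $\omega=\omega(n)$ be any function with $\omega(n)\to\infty$ as $n\to\infty$, and let $\gamma\in(0,1)$ be a constant. If the edge-probability $p=p(n)$ satisfies $\gamma\le p<1$, then there is an interval of length $\lfloor C\omega\sqrt{n}/\log_{1/(1-p)}(n)\rfloor$ that contains $\chi(G_{n,p})$ with high probability, where $C=C(\gamma)>0$ is a constant.
   Context: $G_{n,p}$ denotes the binomial random graph on vertex set $[n]$ in which each pair of vertices is an edge independently with probability $p$; $\chi$ denotes the chromatic number. "With high probability" means with probability tending to $1$ as $n\to\infty$. "There is an interval of length $\ell(n)$ that contains $\chi(G_{n,p})$ with high probability" means there exist intervals $I_n$ of length $\ell(n)$ with $\Pr(\chi(G_{n,p})\in I_n)\to1$. *)

theory Defs
  imports "HOL-Probability.Probability"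
begin

definition all_edges :: "nat \<Rightarrow> nat set set" where
  "all_edges n = {e. \<exists>i j. i < j \<and> j < n \<and> e = {i, j}}"

definition gnp :: "nat \<Rightarrow> real \<Rightarrow> nat set set pmf" where
  "gnp n p = map_pmf (\<lambda>f. {e \<in> all_edges n. f e})
      (Pi_pmf (all_edges n) False (\<lambda>_. bernoulli_pmf p))"

definition proper_colouring :: "nat \<Rightarrow> nat set set \<Rightarrow> nat \<Rightarrow> (nat \<Rightarrow> nat) \<Rightarrow> bool" where
  "proper_colouring n E k c \<longleftrightarrow>
     (\<forall>v<n. c v < k) \<and> (\<forall>u v. {u, v} \<in> E \<and> u \<noteq> v \<longrightarrow> c u \<noteq> c v)"

definition chromatic_number :: "nat \<Rightarrow> nat set set \<Rightarrow> nat" where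
  "chromatic_number n E = (LEAST k. \<exists>c. proper_colouring n E k c)"

end

theory Submission
  imports Defs "HOL-Real_Asymp.Real_Asymp"
begin

text \<open>
  Let \<open>k\<close> be least such that the graph is \<open>k\<close>-colourable with probability at least \<open>1/\<omega>\<^sup>2\<close>, and
  let \<open>Y\<close> be the least number of vertices whose deletion leaves a \<open>k\<close>-colourable graph. Changing the
  edges at one vertex changes \<open>Y\<close> by at most 1, so \<open>Y\<close> has variance at most \<open>n\<close> (Efron--Stein), and
  Chebyshev's inequality gives \<open>Y \<le> 4 * \<omega> * sqrt n\<close> with high probability. It remains to colour an
  arbitrary set of that many vertices with few additional colours. Put \<open>q = 1 - p\<close> and
  \<open>b = log (1/q) n\<close>. If \<open>b < 8\<close>, one colour per vertex is good enough. Otherwise a union bound shows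
  that with high probability every set \<open>T\<close> of at least \<open>n powr (1/4)\<close> vertices contains a vertex with
  at least \<open>q/16 * |T|\<close> non-neighbours in \<open>T\<close>. Passing repeatedly to such non-neighbourhoods produces
  an independent set of size of order \<open>b\<close> in every set of at least \<open>n powr (1/3)\<close> vertices, and
  removing these independent sets one after another colours the remaining vertices.
\<close>

subsection \<open>Variance of functions of independent blocks\<close>

lemma expectation_pair_pmf_finite:
  fixes f :: "'a \<times> 'b \<Rightarrow> real"
  assumes "finite (set_pmf P)" "finite (set_pmf Q)"
  shows "measure_pmf.expectation (pair_pmf P Q) f =
    measure_pmf.expectation P (\<lambda>a. measure_pmf.expectation Q (\<lambda>b. f (a, b)))"
proof -
  have "measure_pmf.expectation (pair_pmf P Q) f =
      (\<Sum>x\<in>set_pmf P \<times> set_pmf Q. f x * pmf (pair_pmf P Q) x)"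
    using assms by (intro integral_measure_pmf_real) auto
  also have "\<dots> = (\<Sum>a\<in>set_pmf P. \<Sum>b\<in>set_pmf Q. f (a, b) * (pmf P a * pmf Q b))"
    by (simp add: sum.cartesian_product case_prod_unfold pmf_pair[symmetric])
  also have "\<dots> = (\<Sum>a\<in>set_pmf P. (\<Sum>b\<in>set_pmf Q. f (a, b) * pmf Q b) * pmf P a)"
    by (simp add: sum_distrib_right sum_distrib_left mult_ac)
  also have "\<dots> = (\<Sum>a\<in>set_pmf P. measure_pmf.expectation Q (\<lambda>b. f (a, b)) * pmf P a)"
    using assms by (simp add: integral_measure_pmf_real[of "set_pmf Q"])
  also have "\<dots> = measure_pmf.expectation P (\<lambda>a. measure_pmf.expectation Q (\<lambda>b. f (a, b)))"
    using assms by (intro integral_measure_pmf_real[symmetric]) auto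
  finally show ?thesis .
qed

text \<open>The bias-variance identity. With \<open>c\<close> the overall mean and \<open>f\<close>
  a section of the function, it splits a second moment into a conditional variance and the squared
  error of the conditional mean.\<close>

lemma expectation_square_dist_finite:
  fixes f :: "'a \<Rightarrow> real"
  assumes "finite (set_pmf P)"
  shows "measure_pmf.expectation P (\<lambda>x. (f x - c)\<^sup>2) =
    measure_pmf.variance P f + (measure_pmf.expectation P f - c)\<^sup>2"
proof -
  note int = integrable_measure_pmf_finite[OF assms]
  define m where "m = measure_pmf.expectation P f"
  have "measure_pmf.expectation P (\<lambda>x. (f x - c)\<^sup>2) =
      measure_pmf.expectation P (\<lambda>x. (f x - m)\<^sup>2 + ((2 * (m - c)) * f x + (c\<^sup>2 - m\<^sup>2)))"
    by (simp add: power2_eq_square algebra_simps)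
  also have "\<dots> = measure_pmf.expectation P (\<lambda>x. (f x - m)\<^sup>2) + ((2 * (m - c)) * m + (c\<^sup>2 - m\<^sup>2))"
    by (simp add: int m_def)
  also have "(2 * (m - c)) * m + (c\<^sup>2 - m\<^sup>2) = (m - c)\<^sup>2"
    by (simp add: power2_eq_square algebra_simps)
  finally show ?thesis by (simp add: m_def)
qed

lemma expectation_le_const:
  fixes f :: "'a \<Rightarrow> real"
  assumes "finite (set_pmf P)" "\<And>x. f x \<le> c"
  shows "measure_pmf.expectation P f \<le> c"
proof -
  have "measure_pmf.expectation P f \<le> measure_pmf.expectation P (\<lambda>_. c)"
    by (rule integral_mono) (auto simp: integrable_measure_pmf_finite assms)
  thus ?thesis by simp
qed

lemma abs_expectation_diff_le:
  fixes f g :: "'a \<Rightarrow> real"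
  assumes "finite (set_pmf P)" "\<And>x. \<bar>f x - g x\<bar> \<le> c"
  shows "\<bar>measure_pmf.expectation P f - measure_pmf.expectation P g\<bar> \<le> c"
proof -
  note int = integrable_measure_pmf_finite[OF assms(1)]
  have "\<bar>measure_pmf.expectation P f - measure_pmf.expectation P g\<bar> =
      \<bar>measure_pmf.expectation P (\<lambda>x. f x - g x)\<bar>"
    by (simp add: int)
  also have "\<dots> \<le> measure_pmf.expectation P (\<lambda>x. \<bar>f x - g x\<bar>)"
    by (rule integral_abs_bound)
  also have "\<dots> \<le> c"
    by (rule expectation_le_const) (use assms in auto)
  finally show ?thesis .
qed

lemma finite_set_Pi_pmf:
  assumes "finite A" "\<And>x. finite (set_pmf (p x))"
  shows "finite (set_pmf (Pi_pmf A d p))"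
  using assms by (auto simp: set_Pi_pmf)

text \<open>Law of total variance, by induction on the number of blocks, conditioning on the last
  one. Freezing it preserves the hypothesis on the others, so the conditional variance is at most
  \<open>n\<close>; the conditional mean varies by at most 1 with the last block, so its squared
  deviation adds at most 1.\<close>

lemma variance_Pi_pmf_blocks_le:
  fixes F :: "('a \<Rightarrow> 'b) \<Rightarrow> real"
  assumes "\<And>i. i < n \<Longrightarrow> finite (A i)"
    and "\<And>i j. i < n \<Longrightarrow> j < n \<Longrightarrow> i \<noteq> j \<Longrightarrow> A i \<inter> A j = {}"
    and fin: "\<And>x. finite (set_pmf (p x))"
    and "\<And>i f g. i < n \<Longrightarrow> (\<And>x. x \<notin> A i \<Longrightarrow> f x = g x) \<Longrightarrow> \<bar>F f - F g\<bar> \<le> 1"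
  shows "measure_pmf.variance (Pi_pmf (\<Union>i<n. A i) d p) F \<le> real n"
  using assms(1,2,4)
proof (induction n arbitrary: F)
  case 0
  then show ?case by simp
next
  case (Suc n)
  define B where "B = (\<Union>i<n. A i)"
  define P where "P = Pi_pmf B d p"
  define Q where "Q = Pi_pmf (A n) d p"
  define H where "H b a = F (\<lambda>x. if x \<in> A n then b x else a x)" for a b
  define g where "g b = measure_pmf.expectation P (H b)" for b
  have finB: "finite B" "finite (A n)" using Suc.prems(1) by (auto simp: B_def)
  have disj: "A n \<inter> B = {}"
  proof -
    have "A n \<inter> A i = {}" if "i < n" for i using Suc.prems(2)[of n i] that by auto
    thus ?thesis by (auto simp: B_def)
  qed
  have fP: "finite (set_pmf P)" and fQ: "finite (set_pmf Q)"
    unfolding P_def Q_def using finB fin by (auto intro: finite_set_Pi_pmf)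
  have "(\<Union>i<Suc n. A i) = A n \<union> B" by (auto simp: B_def less_Suc_eq)
  hence eq: "Pi_pmf (\<Union>i<Suc n. A i) d p =
      map_pmf (\<lambda>(f, g) x. if x \<in> A n then f x else g x) (pair_pmf Q P)"
    using finB disj by (simp add: Pi_pmf_union P_def Q_def)
  \<comment> \<open>\<open>G\<close> will be the identity for the mean and the squared distance to
    \<open>m\<close> for the variance.\<close>
  have ex: "measure_pmf.expectation (Pi_pmf (\<Union>i<Suc n. A i) d p) (\<lambda>f. G (F f)) =
     measure_pmf.expectation Q (\<lambda>b. measure_pmf.expectation P (\<lambda>a. G (H b a)))" for G :: "real \<Rightarrow> real"
    unfolding eq integral_map_pmf expectation_pair_pmf_finite[OF fQ fP] H_def by simp
  define m where "m = measure_pmf.expectation Q g"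
  have m: "measure_pmf.expectation (Pi_pmf (\<Union>i<Suc n. A i) d p) F = m"
    using ex[of "\<lambda>x. x"] by (simp add: m_def g_def[abs_def])
  have IH: "measure_pmf.variance P (H b) \<le> real n" for b
    unfolding P_def B_def
  proof (rule Suc.IH)
    fix i and f g :: "'a \<Rightarrow> 'b" assume i: "i < n" and fg: "\<And>x. x \<notin> A i \<Longrightarrow> f x = g x"
    show "\<bar>H b f - H b g\<bar> \<le> 1"
      unfolding H_def by (rule Suc.prems(3)[of i]) (use i fg in auto)
  qed (use Suc.prems in auto)
  have g_diff: "\<bar>g b - g b'\<bar> \<le> 1" for b b'
    unfolding g_def
    by (rule abs_expectation_diff_le[OF fP], unfold H_def, rule Suc.prems(3)[of n]) auto
  \<comment> \<open>As \<open>m\<close> is the average of \<open>g\<close>, the constant function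
    with value \<open>g b\<close> is compared with \<open>g\<close> itself.\<close>
  have "\<bar>g b - m\<bar> \<le> 1" for b
    using abs_expectation_diff_le[OF fQ, of "\<lambda>_. g b" g 1] g_diff by (simp add: m_def)
  hence g_m: "(g b - m)\<^sup>2 \<le> 1" for b
    by (simp add: abs_square_le_1)
  have "measure_pmf.variance (Pi_pmf (\<Union>i<Suc n. A i) d p) F =
     measure_pmf.expectation Q (\<lambda>b. measure_pmf.variance P (H b) + (g b - m)\<^sup>2)"
    unfolding m ex[of "\<lambda>x. (x - m)\<^sup>2"] g_def
    by (rule Bochner_Integration.integral_cong[OF refl]) (rule expectation_square_dist_finite[OF fP])
  also have "\<dots> \<le> real n + 1"
    by (intro expectation_le_const[OF fQ] add_mono IH g_m)
  finally show ?case by simp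
qed

subsection \<open>Colourings and the deletion number\<close>

text \<open>Stated for induced subgraphs because vertex sets are deleted and coloured separately;
  \<open>colourable I E 1\<close> also serves to say that \<open>I\<close> is independent.\<close>

definition colourable :: "nat set \<Rightarrow> nat set set \<Rightarrow> nat \<Rightarrow> bool" where
  "colourable W E k \<longleftrightarrow>
     (\<exists>c. (\<forall>v\<in>W. c v < k) \<and> (\<forall>u\<in>W. \<forall>v\<in>W. u \<noteq> v \<and> {u, v} \<in> E \<longrightarrow> c u \<noteq> c v))"

definition deletion_number :: "nat \<Rightarrow> nat set set \<Rightarrow> nat \<Rightarrow> nat" where
  "deletion_number n E k =
     (LEAST m. \<exists>S\<subseteq>{..<n}. card S = m \<and> colourable ({..<n} - S) E k)"

lemma colourable_empty: "colourable {} E k"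
  by (simp add: colourable_def)

lemma colourable_card: "finite W \<Longrightarrow> colourable W E (card W)"
proof -
  assume "finite W"
  then obtain c where "bij_betw c W {0..<card W}"
    using ex_bij_betw_finite_nat by blast
  thus ?thesis
    unfolding colourable_def bij_betw_def inj_on_def by (intro exI[of _ c]) auto
qed

lemma colourable_mono: "colourable W E k \<Longrightarrow> k \<le> l \<Longrightarrow> colourable W E l"
  unfolding colourable_def using order.strict_trans2 by (metis (no_types, lifting))

text \<open>Disjoint palettes: \<open>V\<close> keeps its colours, and the vertices of
  \<open>W\<close> outside \<open>V\<close> have theirs shifted by \<open>k\<close>.\<close>

lemma colourable_union:
  assumes "colourable V E k" "colourable W E l"
  shows "colourable (V \<union> W) E (k + l)"
proof -
  obtain c where c: "\<And>v. v \<in> V \<Longrightarrow> c v < k"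
    "\<And>u v. u \<in> V \<Longrightarrow> v \<in> V \<Longrightarrow> u \<noteq> v \<Longrightarrow> {u, v} \<in> E \<Longrightarrow> c u \<noteq> c v"
    using assms(1) unfolding colourable_def by blast
  obtain d where d: "\<And>v. v \<in> W \<Longrightarrow> d v < l"
    "\<And>u v. u \<in> W \<Longrightarrow> v \<in> W \<Longrightarrow> u \<noteq> v \<Longrightarrow> {u, v} \<in> E \<Longrightarrow> d u \<noteq> d v"
    using assms(2) unfolding colourable_def by blast
  have False if "u \<in> V \<union> W" "v \<in> V \<union> W" "u \<noteq> v" "{u, v} \<in> E"
    "(if u \<in> V then c u else k + d u) = (if v \<in> V then c v else k + d v)" for u v
    using that c(1)[of u] c(1)[of v] c(2)[of u v] d(2)[of u v]
    by (auto split: if_splits)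
  moreover have "(if v \<in> V then c v else k + d v) < k + l" if "v \<in> V \<union> W" for v
    using that c(1)[of v] d(1)[of v] by auto
  ultimately show ?thesis
    unfolding colourable_def
    by (intro exI[of _ "\<lambda>v. if v \<in> V then c v else k + d v"]) blast
qed

text \<open>A proper colouring constrains all edges, an induced one only those within
  \<open>{..<n}\<close>; the assumption on \<open>E\<close> places every edge there.\<close>

lemma proper_colouring_iff_colourable:
  assumes "E \<subseteq> all_edges n"
  shows "(\<exists>c. proper_colouring n E k c) \<longleftrightarrow> colourable {..<n} E k"
proof -
  have "u < n \<and> v < n" if "{u, v} \<in> E" for u v
  proof -
    have "{u, v} \<in> all_edges n" using assms that by blast
    thus ?thesis by (auto simp: all_edges_def doubleton_eq_iff)
  qed
  thus ?thesis
    unfolding proper_colouring_def colourable_def by (intro ex_cong1) auto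
qed

lemma chromatic_number_le_iff:
  assumes "E \<subseteq> all_edges n"
  shows "chromatic_number n E \<le> k \<longleftrightarrow> colourable {..<n} E k"
proof -
  have eq: "chromatic_number n E = (LEAST k. colourable {..<n} E k)"
    unfolding chromatic_number_def proper_colouring_iff_colourable[OF assms] ..
  have "colourable {..<n} E n" using colourable_card[of "{..<n}" E] by simp
  hence "colourable {..<n} E (chromatic_number n E)" unfolding eq by (rule LeastI)
  thus ?thesis using colourable_mono unfolding eq by (metis Least_le)
qed

lemma deletion_number_obtain:
  obtains S where "S \<subseteq> {..<n}" "card S = deletion_number n E k" "colourable ({..<n} - S) E k"
proof -
  have "\<exists>S\<subseteq>{..<n}. card S = n \<and> colourable ({..<n} - S) E k"
    by (rule exI[of _ "{..<n}"]) (simp add: colourable_empty)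
  hence "\<exists>m. \<exists>S\<subseteq>{..<n}. card S = m \<and> colourable ({..<n} - S) E k" by blast
  from LeastI_ex[OF this] show ?thesis
    unfolding deletion_number_def[symmetric] using that by blast
qed

lemma deletion_number_le:
  assumes "S \<subseteq> {..<n}" "colourable ({..<n} - S) E k"
  shows "deletion_number n E k \<le> card S"
  unfolding deletion_number_def by (rule Least_le) (use assms in blast)

lemma deletion_number_eq_0_iff:
  "deletion_number n E k = 0 \<longleftrightarrow> colourable {..<n} E k"
proof
  assume "deletion_number n E k = 0"
  moreover obtain S where S: "S \<subseteq> {..<n}" "card S = deletion_number n E k" "colourable ({..<n} - S) E k"
    by (rule deletion_number_obtain)
  moreover have "finite S" using S(1) finite_subset by blast
  ultimately show "colourable {..<n} E k" by simp
next
  assume "colourable {..<n} E k"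
  thus "deletion_number n E k = 0" using deletion_number_le[of "{}" n E k] by simp
qed

text \<open>Adding \<open>j\<close> to an optimal deletion set for \<open>E\<close> removes every
  edge on which the two graphs can differ.\<close>

lemma deletion_number_change_vertex:
  assumes "j < n" and agree: "\<And>u v. u \<noteq> j \<Longrightarrow> v \<noteq> j \<Longrightarrow> {u, v} \<in> E \<longleftrightarrow> {u, v} \<in> E'"
  shows "deletion_number n E' k \<le> deletion_number n E k + 1"
proof -
  obtain S where S: "S \<subseteq> {..<n}" "card S = deletion_number n E k" "colourable ({..<n} - S) E k"
    by (rule deletion_number_obtain)
  obtain c where c: "\<forall>v\<in>{..<n} - S. c v < k"
    "\<forall>u\<in>{..<n} - S. \<forall>v\<in>{..<n} - S. u \<noteq> v \<and> {u, v} \<in> E \<longrightarrow> c u \<noteq> c v"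
    using S(3) unfolding colourable_def by blast
  have "colourable ({..<n} - insert j S) E' k"
    unfolding colourable_def using c agree by (intro exI[of _ c]) auto
  hence "deletion_number n E' k \<le> card (insert j S)"
    using S(1) assms(1) by (intro deletion_number_le) auto
  also have "\<dots> \<le> card S + 1" by (simp add: card_insert_le_m1 card_insert_if finite_subset[OF S(1)])
  finally show ?thesis using S(2) by simp
qed

section \<open>Vertex exposure and concentration of the deletion number\<close>

definition back_edges :: "nat \<Rightarrow> nat set set" where
  "back_edges j = {{i, j} |i. i < j}"

lemma finite_back_edges: "finite (back_edges j)"
  unfolding back_edges_def by simp

lemma back_edges_disjoint: "i \<noteq> j \<Longrightarrow> back_edges i \<inter> back_edges j = {}"
  by (auto simp: back_edges_def doubleton_eq_iff)

lemma all_edges_eq_Union_back_edges: "all_edges n = (\<Union>j<n. back_edges j)"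
  by (auto simp: all_edges_def back_edges_def)

lemma finite_all_edges: "finite (all_edges n)"
  by (simp add: all_edges_eq_Union_back_edges finite_back_edges)

text \<open>Grouping each edge under its larger endpoint gives only \<open>n\<close> independent
  blocks, and altering block \<open>j\<close> changes only edges at \<open>j\<close>, hence the
  deletion number by at most 1.\<close>

lemma variance_deletion_number_le:
  "measure_pmf.variance (gnp n p) (\<lambda>E. real (deletion_number n E k)) \<le> real n"
proof -
  let ?F = "\<lambda>f. real (deletion_number n {e \<in> all_edges n. f e} k)"
  have "measure_pmf.variance (Pi_pmf (\<Union>j<n. back_edges j) False (\<lambda>_. bernoulli_pmf p)) ?F \<le> real n"
  proof (rule variance_Pi_pmf_blocks_le)
    fix j :: nat and f g :: "nat set \<Rightarrow> bool"
    assume j: "j < n" and fg: "\<And>x. x \<notin> back_edges j \<Longrightarrow> f x = g x"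
    have *: "{u, v} \<notin> back_edges j" if "u \<noteq> j" "v \<noteq> j" for u v
      using that by (auto simp: back_edges_def doubleton_eq_iff)
    have "f {u, v} = g {u, v}" if "u \<noteq> j" "v \<noteq> j" for u v
      using fg * that by blast
    hence "deletion_number n {e \<in> all_edges n. f e} k \<le> deletion_number n {e \<in> all_edges n. g e} k + 1"
      "deletion_number n {e \<in> all_edges n. g e} k \<le> deletion_number n {e \<in> all_edges n. f e} k + 1"
      using j by (auto intro!: deletion_number_change_vertex[of j, unfolded Suc_eq_plus1[symmetric]])
    thus "\<bar>?F f - ?F g\<bar> \<le> 1" by linarith
  qed (auto simp: finite_back_edges back_edges_disjoint)
  thus ?thesis by (simp add: gnp_def all_edges_eq_Union_back_edges)
qed

lemma finite_set_gnp: "finite (set_pmf (gnp n p))"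
  unfolding gnp_def set_map_pmf
  by (intro finite_imageI finite_set_Pi_pmf finite_all_edges) auto

lemma set_gnp_subset: "E \<in> set_pmf (gnp n p) \<Longrightarrow> E \<subseteq> all_edges n"
  by (auto simp: gnp_def)

text \<open>If the graph is \<open>k\<close>-colourable with probability at least \<open>1/w\<^sup>2\<close>, then by Chebyshev the mean
  of the deletion number is less than \<open>2 * w * sqrt n\<close>, for otherwise the value 0 would be too unlikely.\<close>

lemma deletion_number_small:
  assumes n: "0 < n" and w: "0 < w"
    and k: "measure_pmf.prob (gnp n p) {E. deletion_number n E k = 0} \<ge> 1 / w\<^sup>2"
  shows "measure_pmf.prob (gnp n p) {E. real (deletion_number n E k) \<ge> 4 * w * sqrt n} \<le> 1 / w\<^sup>2"
proof -
  define Y where "Y E = real (deletion_number n E k)" for E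
  define \<mu> where "\<mu> = measure_pmf.expectation (gnp n p) Y"
  \<comment> \<open>With this \<open>t\<close> Chebyshev gives \<open>1 / (4 * w\<^sup>2)\<close>,
    strictly below the assumed \<open>1 / w\<^sup>2\<close>, and \<open>2 * t\<close> is the
    deviation claimed.\<close>
  define t where "t = 2 * w * sqrt n"
  have t: "t > 0" using n w by (simp add: t_def)
  have "measure_pmf.prob (gnp n p) {E. \<bar>Y E - \<mu>\<bar> \<ge> t} \<le> measure_pmf.variance (gnp n p) Y / t\<^sup>2"
    using measure_pmf.Chebyshev_inequality[of Y "gnp n p" t] t
    by (simp add: \<mu>_def integrable_measure_pmf_finite finite_set_gnp)
  also have "\<dots> \<le> real n / t\<^sup>2"
    using variance_deletion_number_le[of n p k] by (intro divide_right_mono) (auto simp: Y_def[abs_def])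
  also have "\<dots> = 1 / (4 * w\<^sup>2)"
    using n w by (simp add: t_def power_mult_distrib)
  finally have cheb: "measure_pmf.prob (gnp n p) {E. \<bar>Y E - \<mu>\<bar> \<ge> t} \<le> 1 / (4 * w\<^sup>2)" .
  have lt: "1 / (4 * w\<^sup>2) < 1 / w\<^sup>2" using w by (simp add: field_simps)
  have "\<mu> < t"
  proof (rule ccontr)
    assume "\<not> \<mu> < t"
    hence "{E. deletion_number n E k = 0} \<subseteq> {E. \<bar>Y E - \<mu>\<bar> \<ge> t}"
      by (auto simp: Y_def)
    hence "measure_pmf.prob (gnp n p) {E. deletion_number n E k = 0}
        \<le> measure_pmf.prob (gnp n p) {E. \<bar>Y E - \<mu>\<bar> \<ge> t}"
      by (intro measure_pmf.finite_measure_mono) auto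
    thus False using k cheb lt by linarith
  qed
  hence "{E. Y E \<ge> 4 * w * sqrt n} \<subseteq> {E. \<bar>Y E - \<mu>\<bar> \<ge> t}"
    by (auto simp: t_def)
  hence "measure_pmf.prob (gnp n p) {E. Y E \<ge> 4 * w * sqrt n}
      \<le> measure_pmf.prob (gnp n p) {E. \<bar>Y E - \<mu>\<bar> \<ge> t}"
    by (intro measure_pmf.finite_measure_mono) auto
  thus ?thesis using cheb lt by (simp add: Y_def)
qed

subsection \<open>Independent sets in every large vertex set\<close>

definition nonneighbour_rich :: "nat \<Rightarrow> nat set set \<Rightarrow> real \<Rightarrow> real \<Rightarrow> bool" where
  "nonneighbour_rich n E t \<delta> \<longleftrightarrow> (\<forall>T\<subseteq>{..<n}. t \<le> real (card T) \<longrightarrow>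
     (\<exists>v\<in>T. \<delta> * real (card T) \<le> real (card {u \<in> T. u \<noteq> v \<and> {u, v} \<notin> E})))"

lemma colourable_1_iff:
  "colourable I E 1 \<longleftrightarrow> (\<forall>u\<in>I. \<forall>v\<in>I. u \<noteq> v \<longrightarrow> {u, v} \<notin> E)"
proof
  assume "colourable I E 1"
  thus "\<forall>u\<in>I. \<forall>v\<in>I. u \<noteq> v \<longrightarrow> {u, v} \<notin> E"
    unfolding colourable_def by (metis less_one)
next
  assume "\<forall>u\<in>I. \<forall>v\<in>I. u \<noteq> v \<longrightarrow> {u, v} \<notin> E"
  thus "colourable I E 1" unfolding colourable_def by (intro exI[of _ "\<lambda>_. 0"]) auto
qed

text \<open>Greedy choice: pick a rich vertex and continue inside its non-neighbourhood. Each round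
  keeps at least a fraction \<delta> of the set, so after \<open>j\<close> rounds at least
  \<open>t > 0\<close> vertices remain and supply one more member.\<close>

lemma nonneighbour_rich_independent_set:
  assumes rich: "nonneighbour_rich n E t \<delta>" and t: "0 < t" and \<delta>: "0 \<le> \<delta>" "\<delta> \<le> 1"
    and "T \<subseteq> {..<n}" "t \<le> real (card T) * \<delta> ^ j"
  shows "\<exists>I\<subseteq>T. card I = Suc j \<and> colourable I E 1"
  using assms(5,6)
proof (induction j arbitrary: T)
  case 0
  hence "card T \<noteq> 0" using t by (intro notI) simp
  then obtain v where "v \<in> T" by (metis card.empty ex_in_conv)
  thus ?case by (intro exI[of _ "{v}"]) (auto simp: colourable_1_iff[simplified])
next
  case (Suc j)
  \<comment> \<open>Since \<delta> is at most 1, \<open>T\<close> itself reaches the threshold and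
    richness applies to it.\<close>
  have "real (card T) * \<delta> ^ Suc j \<le> real (card T) * 1"
    using \<delta> by (intro mult_left_mono power_le_one) auto
  hence "t \<le> real (card T)" using Suc.prems by simp
  then obtain v where v: "v \<in> T"
    "\<delta> * real (card T) \<le> real (card {u \<in> T. u \<noteq> v \<and> {u, v} \<notin> E})"
    using rich Suc.prems(1) unfolding nonneighbour_rich_def by blast
  define T' where "T' = {u \<in> T. u \<noteq> v \<and> {u, v} \<notin> E}"
  have "t \<le> \<delta> * real (card T) * \<delta> ^ j" using Suc.prems(2) by (simp add: mult_ac)
  also have "\<dots> \<le> real (card T') * \<delta> ^ j"
    using v(2) \<delta> by (intro mult_right_mono) (auto simp: T'_def)
  finally have "t \<le> real (card T') * \<delta> ^ j" .
  moreover have "T' \<subseteq> {..<n}" using Suc.prems(1) by (auto simp: T'_def)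
  ultimately obtain I where I: "I \<subseteq> T'" "card I = Suc j" "colourable I E 1"
    using Suc.IH by blast
  have "finite I" using I(2) card.infinite by fastforce
  moreover have "v \<notin> I" using I(1) by (auto simp: T'_def)
  moreover have "colourable (insert v I) E 1"
    using I(1,3) unfolding colourable_1_iff T'_def by (auto simp: insert_commute)
  ultimately show ?case
    using I v(1) by (intro exI[of _ "insert v I"]) (auto simp: T'_def)
qed

text \<open>While at least \<open>r\<close> vertices remain, an independent \<open>k\<close>-set is
  removed at the price of one colour; the fewer than \<open>r\<close> vertices left at the end get a
  colour each.\<close>

lemma colourable_by_extraction:
  assumes "finite U" and k: "0 < k" and r: "0 \<le> r"
    and "\<And>T. T \<subseteq> U \<Longrightarrow> r \<le> real (card T) \<Longrightarrow> \<exists>I\<subseteq>T. card I = k \<and> colourable I E 1"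
  shows "\<exists>K. colourable U E K \<and> real K \<le> real (card U) / real k + r"
  using assms(1,4)
proof (induction U rule: finite_psubset_induct)
  case (psubset U)
  show ?case
  proof (cases "r \<le> real (card U)")
    case False
    have "0 \<le> real (card U) / real k" by simp
    hence "real (card U) \<le> real (card U) / real k + r" using False by linarith
    thus ?thesis using colourable_card[OF psubset.hyps(1)] by blast
  next
    case True
    then obtain I where I: "I \<subseteq> U" "card I = k" "colourable I E 1"
      using psubset.prems[of U] by blast
    have "I \<noteq> {}" using I(2) k by auto
    hence "U - I \<subset> U" using I(1) by blast
    moreover have "\<exists>I\<subseteq>T. card I = k \<and> colourable I E 1"
      if "T \<subseteq> U - I" "r \<le> real (card T)" for T
      using psubset.prems[of T] that by blast
    ultimately obtain K where K: "colourable (U - I) E K" "real K \<le> real (card (U - I)) / real k + r"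
      using psubset.IH[of "U - I"] by blast
    have fI: "finite I" using I(1) psubset.hyps(1) finite_subset by blast
    have "card I \<le> card U" using I(1) psubset.hyps(1) by (rule card_mono[rotated])
    hence "real (card (U - I)) = real (card U) - real k"
      using I by (simp add: card_Diff_subset[OF fI])
    hence "real (K + 1) \<le> real (card U) / real k + r"
      using K(2) k by (simp add: diff_divide_distrib)
    moreover have "(U - I) \<union> I = U" using I(1) by blast
    ultimately show ?thesis using colourable_union[OF K(1) I(3)] by metis
  qed
qed

section \<open>Richness of all large vertex sets: Chernoff and union bounds\<close>

lemma prob_few_False_le:
  assumes S: "finite S" "M \<subseteq> S" and p: "0 \<le> p" "p \<le> 1"
  shows "measure_pmf.prob (Pi_pmf S d (\<lambda>_. bernoulli_pmf p)) {f. real (card {e \<in> M. \<not> f e}) \<le> a}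
    \<le> 2 powr a * exp (- (1 - p) * real (card M) / 2)"
proof -
  let ?P = "Pi_pmf S d (\<lambda>_. bernoulli_pmf p)"
  \<comment> \<open>Chernoff's method at base 2: a factor 1/2 for each \<open>False\<close> in
    \<open>M\<close> makes the product \<open>2 powr - X\<close>, where \<open>X\<close> counts
    these coordinates. Markov's inequality applies, and by independence the mean is a product of
    factors \<open>1 - (1 - p) / 2\<close>.\<close>
  define u :: "'a \<Rightarrow> bool \<Rightarrow> real" where "u e b = (if e \<in> M \<and> \<not> b then 1 / 2 else 1)" for e b
  have fM: "finite M" using S finite_subset by blast
  have fP: "finite (set_pmf ?P)" using S(1) by (intro finite_set_Pi_pmf) auto
  have prod_u: "(\<Prod>e\<in>S. u e (f e)) = 2 powr - real (card {e \<in> M. \<not> f e})" for f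
  proof -
    have "(\<Prod>e\<in>S. u e (f e)) = (\<Prod>e\<in>{e \<in> M. \<not> f e}. 1 / 2)"
      unfolding u_def using S by (intro prod.mono_neutral_cong_right) auto
    also have "\<dots> = (1 / 2) ^ card {e \<in> M. \<not> f e}" by simp
    finally show ?thesis by (simp add: powr_minus powr_realpow power_one_over inverse_eq_divide)
  qed
  have "measure_pmf.prob ?P {f. real (card {e \<in> M. \<not> f e}) \<le> a} =
      measure_pmf.prob ?P {f \<in> space (measure_pmf ?P). (\<Prod>e\<in>S. u e (f e)) \<ge> 2 powr - a}"
    by (simp add: prod_u)
  also have "\<dots> \<le> measure_pmf.expectation ?P (\<lambda>f. \<Prod>e\<in>S. u e (f e)) / 2 powr - a"
    by (rule integral_Markov_inequality_measure[where A = "{}"])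
      (auto simp: integrable_measure_pmf_finite[OF fP] u_def intro!: prod_nonneg)
  also have "measure_pmf.expectation ?P (\<lambda>f. \<Prod>e\<in>S. u e (f e)) =
      (\<Prod>e\<in>S. measure_pmf.expectation (bernoulli_pmf p) (u e))"
    by (rule expectation_prod_Pi_pmf) (auto simp: S integrable_measure_pmf_finite u_def)
  also have "\<dots> = (\<Prod>e\<in>M. 1 - (1 - p) / 2)"
    using S p by (intro prod.mono_neutral_cong_right) (auto simp: u_def field_simps)
  also have "\<dots> \<le> (\<Prod>e\<in>M. exp (- (1 - p) / 2))"
  proof (rule prod_mono)
    show "0 \<le> 1 - (1 - p) / 2 \<and> 1 - (1 - p) / 2 \<le> exp (- (1 - p) / 2)" for e :: 'a
      using p exp_ge_add_one_self[of "- (1 - p) / 2"] by (auto simp: field_simps)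
  qed
  also have "\<dots> = exp (- (1 - p) * real (card M) / 2)"
    by (simp add: exp_of_nat_mult[symmetric] mult_ac)
  finally show ?thesis by (simp add: powr_minus field_simps divide_right_mono)
qed

lemma card_edges_inside:
  assumes "T \<subseteq> {..<n}"
  shows "card {e \<in> all_edges n. e \<subseteq> T} = card T choose 2"
proof -
  have fT: "finite T" using assms finite_subset by blast
  have "{e \<in> all_edges n. e \<subseteq> T} = {e. e \<subseteq> T \<and> card e = 2}"
  proof (intro equalityI subsetI)
    fix e assume "e \<in> {e \<in> all_edges n. e \<subseteq> T}"
    thus "e \<in> {e. e \<subseteq> T \<and> card e = 2}" by (auto simp: all_edges_def)
  next
    fix e assume "e \<in> {e. e \<subseteq> T \<and> card e = 2}"
    then obtain u v where e: "e = {u, v}" "u \<noteq> v" "u \<in> T" "v \<in> T"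
      by (auto simp: card_2_iff)
    show "e \<in> {e \<in> all_edges n. e \<subseteq> T}"
    proof (cases "u < v")
      case True
      thus ?thesis using e assms by (auto simp: all_edges_def)
    next
      case False
      hence "v < u" "e = {v, u}" using e by auto
      thus ?thesis using e assms unfolding all_edges_def by blast
    qed
  qed
  thus ?thesis using n_subsets[OF fT] by simp
qed

text \<open>Mapping a vertex and one of its non-neighbours to the pair they form covers all nonedges
  inside \<open>T\<close>, so their number is at most the sum of the non-degrees.\<close>

lemma card_nonedges_le:
  assumes "finite T" "\<And>v. v \<in> T \<Longrightarrow> real (card {u \<in> T. u \<noteq> v \<and> {u, v} \<notin> E}) \<le> d"
  shows "real (card {e \<in> all_edges n. e \<subseteq> T \<and> e \<notin> E}) \<le> real (card T) * d"
proof -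
  let ?N = "\<lambda>v. {u \<in> T. u \<noteq> v \<and> {u, v} \<notin> E}"
  have sub: "{e \<in> all_edges n. e \<subseteq> T \<and> e \<notin> E} \<subseteq> (\<lambda>(v, u). {u, v}) ` Sigma T ?N"
  proof
    fix e assume "e \<in> {e \<in> all_edges n. e \<subseteq> T \<and> e \<notin> E}"
    then obtain i j where e: "i < j" "e = {i, j}" "e \<subseteq> T" "e \<notin> E" by (auto simp: all_edges_def)
    hence "(j, i) \<in> Sigma T ?N" by auto
    thus "e \<in> (\<lambda>(v, u). {u, v}) ` Sigma T ?N" using e(2) by force
  qed
  have fin: "finite (Sigma T ?N)" using assms(1) by auto
  have "card {e \<in> all_edges n. e \<subseteq> T \<and> e \<notin> E} \<le> card (Sigma T ?N)"
    using card_mono[OF finite_imageI[OF fin] sub] card_image_le[OF fin] by (rule order_trans)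
  also have "\<dots> = (\<Sum>v\<in>T. card (?N v))" using assms(1) by (intro card_SigmaI) auto
  finally have "real (card {e \<in> all_edges n. e \<subseteq> T \<and> e \<notin> E}) \<le> (\<Sum>v\<in>T. real (card (?N v)))"
    unfolding of_nat_sum[symmetric] of_nat_le_iff .
  also have "\<dots> \<le> (\<Sum>v\<in>T. d)" by (rule sum_mono) (rule assms(2))
  finally show ?thesis by simp
qed

text \<open>Without such a vertex, \<open>T\<close> spans at most \<open>q * t\<^sup>2 / 16\<close>
  nonedges, where \<open>t\<close> is its size and \<open>q = 1 - p\<close>. The expected number is
  at least \<open>q * t\<^sup>2 / 4\<close>, so the Chernoff bound applies.\<close>

lemma prob_no_nonneighbour_rich_vertex_le:
  assumes T: "T \<subseteq> {..<n}" "2 \<le> card T" and p: "0 \<le> p" "p \<le> 1"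
  shows "measure_pmf.prob (gnp n p)
      {E. \<forall>v\<in>T. real (card {u \<in> T. u \<noteq> v \<and> {u, v} \<notin> E}) < (1 - p) / 16 * real (card T)}
    \<le> exp (- (1 - p) * (real (card T))\<^sup>2 / 16)"
proof -
  define t where "t = real (card T)"
  define q where "q = 1 - p"
  define M where "M = {e \<in> all_edges n. e \<subseteq> T}"
  let ?P = "Pi_pmf (all_edges n) False (\<lambda>_. bernoulli_pmf p)"
  have fT: "finite T" using T(1) finite_subset by blast
  have t: "t \<ge> 2" using T(2) by (simp add: t_def)
  \<comment> \<open>Evenness makes the integer division in the binomial coefficient exact over the
    reals.\<close>
  have "even (card T * (card T - 1))" by auto
  hence "real (card M) = t * (t - 1) / 2"
    using T by (simp add: M_def card_edges_inside choose_two t_def of_nat_diff real_of_nat_div)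
  moreover have "t * 2 \<le> t * t" using t by (intro mult_left_mono) auto
  ultimately have M: "real (card M) \<ge> t\<^sup>2 / 4"
    by (simp add: power2_eq_square algebra_simps)
  have "measure_pmf.prob (gnp n p)
      {E. \<forall>v\<in>T. real (card {u \<in> T. u \<noteq> v \<and> {u, v} \<notin> E}) < q / 16 * t}
    = measure_pmf.prob ?P {f. \<forall>v\<in>T. real (card {u \<in> T. u \<noteq> v \<and> {u, v} \<notin> {e \<in> all_edges n. f e}}) < q / 16 * t}"
    unfolding gnp_def by (simp add: vimage_def)
  also have "\<dots> \<le> measure_pmf.prob ?P {f. real (card {e \<in> M. \<not> f e}) \<le> q * t\<^sup>2 / 16}"
  proof (rule measure_pmf.finite_measure_mono, safe)
    fix f assume f: "\<forall>v\<in>T. real (card {u \<in> T. u \<noteq> v \<and> {u, v} \<notin> {e \<in> all_edges n. f e}}) < q / 16 * t"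
    have "{e \<in> M. \<not> f e} = {e \<in> all_edges n. e \<subseteq> T \<and> e \<notin> {e \<in> all_edges n. f e}}"
      by (auto simp: M_def)
    moreover have "real (card {e \<in> all_edges n. e \<subseteq> T \<and> e \<notin> {e \<in> all_edges n. f e}}) \<le> t * (q / 16 * t)"
      unfolding t_def by (rule card_nonedges_le[OF fT]) (use f in \<open>auto simp: t_def intro: less_imp_le\<close>)
    ultimately show "real (card {e \<in> M. \<not> f e}) \<le> q * t\<^sup>2 / 16"
      by (simp add: power2_eq_square mult_ac)
  qed auto
  also have "\<dots> \<le> 2 powr (q * t\<^sup>2 / 16) * exp (- q * real (card M) / 2)"
    unfolding q_def by (rule prob_few_False_le) (auto simp: finite_all_edges M_def p)
  also have "\<dots> \<le> exp (q * t\<^sup>2 / 16) * exp (- q * t\<^sup>2 / 8)"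
  proof (rule mult_mono)
    have "q * t\<^sup>2 / 16 * ln 2 \<le> q * t\<^sup>2 / 16 * 1"
      using p ln_2_less_1 by (intro mult_left_mono) (auto simp: q_def)
    thus "2 powr (q * t\<^sup>2 / 16) \<le> exp (q * t\<^sup>2 / 16)" by (simp add: powr_def)
    have "q * (t\<^sup>2 / 4) \<le> q * real (card M)" using M p by (intro mult_left_mono) (auto simp: q_def)
    thus "exp (- q * real (card M) / 2) \<le> exp (- q * t\<^sup>2 / 8)" by simp
  qed auto
  also have "\<dots> = exp (- q * t\<^sup>2 / 16)" by (simp add: exp_add[symmetric])
  finally show ?thesis by (simp add: q_def t_def)
qed

text \<open>The binomial theorem in subset form; it evaluates the union bound over vertex sets of
  all sizes at once.\<close>

lemma sum_Pow_power_card: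
  fixes x :: real
  assumes "finite A"
  shows "(\<Sum>T\<in>Pow A. x ^ card T) = (x + 1) ^ card A"
  using prod_add[OF assms, of "\<lambda>_. x" "\<lambda>_. 1"] by simp

text \<open>A set of size \<open>m \<ge> t\<close> fails with probability at most
  \<open>x ^ m\<close>, where \<open>x = exp (- q * t / 16)\<close> and \<open>q = 1 - p\<close>.
  Summing over nonempty sets gives at most \<open>exp (n * x) - 1\<close>, and \<open>large\<close>
  yields \<open>x \<le> 1 / n\<^sup>2\<close>.\<close>

lemma prob_not_nonneighbour_rich_le:
  assumes p: "0 \<le> p" "p \<le> 1" and t: "2 \<le> t" and n: "0 < n"
    and large: "32 * ln (real n) \<le> (1 - p) * t"
  shows "measure_pmf.prob (gnp n p) {E. \<not> nonneighbour_rich n E t ((1 - p) / 16)}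
    \<le> exp (1 / real n) - 1"
proof -
  define q where "q = 1 - p"
  define x where "x = exp (- q * t / 16)"
  define B where "B T = {E. \<forall>v\<in>T. real (card {u \<in> T. u \<noteq> v \<and> {u, v} \<notin> E}) < q / 16 * real (card T)}"
    for T :: "nat set"
  define I where "I = {T. T \<subseteq> {..<n} \<and> t \<le> real (card T)}"
  have finI: "finite I" by (rule finite_subset[of _ "Pow {..<n}"]) (auto simp: I_def)
  have "{E. \<not> nonneighbour_rich n E t (q / 16)} = (\<Union>T\<in>I. B T)"
    by (auto simp: nonneighbour_rich_def I_def B_def not_le)
  hence "measure_pmf.prob (gnp n p) {E. \<not> nonneighbour_rich n E t (q / 16)}
      \<le> (\<Sum>T\<in>I. measure_pmf.prob (gnp n p) (B T))"
    using finI by (auto intro!: measure_pmf.finite_measure_subadditive_finite)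
  also have "\<dots> \<le> (\<Sum>T\<in>I. x ^ card T)"
  proof (rule sum_mono)
    fix T assume "T \<in> I"
    hence T: "T \<subseteq> {..<n}" "t \<le> real (card T)" by (auto simp: I_def)
    have "measure_pmf.prob (gnp n p) (B T) \<le> exp (- q * (real (card T))\<^sup>2 / 16)"
      unfolding B_def q_def by (rule prob_no_nonneighbour_rich_vertex_le) (use T t p in auto)
    also have "q * t * real (card T) \<le> q * real (card T) * real (card T)"
      using T p by (intro mult_right_mono mult_left_mono) (auto simp: q_def)
    hence "exp (- q * (real (card T))\<^sup>2 / 16) \<le> exp (real (card T) * (- q * t / 16))"
      by (simp add: power2_eq_square mult_ac)
    also have "\<dots> = x ^ card T" unfolding x_def by (rule exp_of_nat_mult)
    finally show "measure_pmf.prob (gnp n p) (B T) \<le> x ^ card T" .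
  qed
  \<comment> \<open>The empty set is below the threshold \<open>t\<close>; leaving it out produces
    the \<open>- 1\<close>.\<close>
  also have "\<dots> \<le> (\<Sum>T\<in>Pow {..<n} - {{}}. x ^ card T)"
    using t by (intro sum_mono2) (auto simp: I_def x_def)
  also have "\<dots> = (x + 1) ^ n - 1"
    by (simp add: sum_diff1 sum_Pow_power_card)
  also have "\<dots> \<le> exp x ^ n - 1"
    using exp_ge_add_one_self[of x] by (intro diff_right_mono power_mono) (auto simp: x_def add.commute)
  also have "exp x ^ n = exp (real n * x)" by (rule exp_of_nat_mult[symmetric])
  also have "real n * x \<le> 1 / real n"
  proof -
    have "x \<le> exp (- (2 * ln (real n)))" using large by (simp add: x_def q_def algebra_simps)
    also have "\<dots> = 1 / (real n)\<^sup>2"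
      using n by (simp add: exp_minus exp_double inverse_eq_divide)
    finally have "real n * x \<le> real n * (1 / (real n)\<^sup>2)" by (rule mult_left_mono) simp
    thus ?thesis using n by (simp add: power2_eq_square)
  qed
  finally show ?thesis by (simp add: q_def)
qed

text \<open>Every set of \<open>n powr (1/3)\<close> vertices admits \<open>j\<close> greedy rounds
  before falling below \<open>n powr (1/4)\<close>, so independent sets of order
  \<open>log (1/q) n\<close> can be extracted until fewer than \<open>n powr (1/3)\<close> vertices
  remain.\<close>

lemma colourable_nonneighbour_rich:
  assumes n: "2 \<le> n" and q: "0 < q" "ln (1 / q) \<ge> L" and L: "0 < L"
    and rich: "nonneighbour_rich n E (real n powr (1 / 4)) (q / 16)"
    and U: "U \<subseteq> {..<n}"
  shows "\<exists>K. colourable U E K \<and>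
    real K \<le> 12 * (1 + ln 16 / L) * real (card U) / log (1 / q) (real n) + real n powr (1 / 3)"
proof -
  \<comment> \<open>Chosen so that \<open>(q / 16) powr y = n powr (- (1/12))\<close>, where 1/12 =
    1/3 - 1/4 is the loss that can be afforded.\<close>
  define y where "y = ln (real n) / (12 * ln (16 / q))"
  define j where "j = nat \<lfloor>y\<rfloor>"
  have lnn: "ln (real n) > 0" using n by simp
  have lq: "ln (1 / q) > 0" using q L by linarith
  have q1: "q < 1" using lq q(1) by (simp add: ln_div)
  have l16: "ln (16 / q) = ln 16 + ln (1 / q)" using q(1) by (simp add: ln_div)
  have "ln (16::real) > 0" by simp
  hence l16': "ln (16 / q) > 0" using l16 lq by linarith
  have y: "y \<ge> 0" using lnn l16' by (simp add: y_def)
  have j: "real j \<le> y" "y \<le> real (Suc j)" using y by (auto simp: j_def) linarith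
  have ext: "\<exists>I\<subseteq>T. card I = Suc j \<and> colourable I E 1"
    if T: "T \<subseteq> U" "real n powr (1 / 3) \<le> real (card T)" for T
  proof (rule nonneighbour_rich_independent_set[OF rich])
    have "real j * ln (16 / q) \<le> y * ln (16 / q)" using j l16' by (intro mult_right_mono) auto
    also have "\<dots> = ln (real n) / 12" using l16' by (simp add: y_def)
    finally have "- (ln (real n) / 12) \<le> real j * (- ln (16 / q))" by simp
    hence "exp (- (ln (real n) / 12)) \<le> exp (- ln (16 / q)) ^ j"
      by (simp add: exp_of_nat_mult[symmetric])
    also have "exp (- ln (16 / q)) = q / 16" using q(1) by (simp add: exp_minus)
    finally have "real n powr (- (1 / 12)) \<le> (q / 16) ^ j" using n by (simp add: powr_def)
    hence "real n powr (1 / 3) * real n powr (- (1 / 12)) \<le> real (card T) * (q / 16) ^ j"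
      using T(2) by (intro mult_mono) auto
    thus "real n powr (1 / 4) \<le> real (card T) * (q / 16) ^ j"
      by (simp add: powr_add[symmetric])
  qed (use n q q1 T U in auto)
  obtain K where K: "colourable U E K" "real K \<le> real (card U) / real (Suc j) + real n powr (1 / 3)"
    using colourable_by_extraction[of U "Suc j" "real n powr (1 / 3)" E] ext finite_subset[OF U] by auto
  \<comment> \<open>The lower bound \<open>L\<close> on \<open>ln (1 / q)\<close> absorbs the
    additive \<open>ln 16\<close> into a constant factor.\<close>
  have "ln 16 * L \<le> ln 16 * ln (1 / q)" using q(2) by (intro mult_left_mono) auto
  hence "ln (16 / q) \<le> (1 + ln 16 / L) * ln (1 / q)" unfolding l16 using L by (simp add: field_simps)
  hence le: "12 * ln (16 / q) / ln (real n) \<le> 12 * ((1 + ln 16 / L) * ln (1 / q)) / ln (real n)"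
    using lnn by (intro divide_right_mono mult_left_mono) auto
  have "y > 0" using lnn l16' by (simp add: y_def)
  \<comment> \<open>The extra vertex beyond the \<open>j\<close> rounds makes up for rounding
    \<open>y\<close> down, even when \<open>j = 0\<close>.\<close>
  hence "real (card U) / real (Suc j) \<le> real (card U) / y"
    using j by (intro divide_left_mono) auto
  also have "\<dots> = real (card U) * (12 * ln (16 / q) / ln (real n))" by (simp add: y_def)
  also have "\<dots> \<le> real (card U) * (12 * ((1 + ln 16 / L) * ln (1 / q)) / ln (real n))"
    using le by (intro mult_left_mono) auto
  also have "\<dots> = 12 * (1 + ln 16 / L) * real (card U) / log (1 / q) (real n)"
    by (simp add: log_def)
  finally show ?thesis using K by (intro exI[of _ K]) simp
qed

subsection \<open>Concentration of the chromatic number\<close>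

text \<open>The second and third bounds serve the union bound once
  \<open>1 - p \<ge> n powr (- (1/8))\<close>; the last absorbs the \<open>n powr (1/3)\<close>
  leftover colours.\<close>

lemma eventually_large:
  assumes L: "0 < L"
  shows "\<forall>\<^sub>F n in sequentially. 2 \<le> n \<and> 2 \<le> real n powr (1 / 4) \<and>
    32 * ln (real n) \<le> real n powr (1 / 8) \<and>
    real n powr (1 / 3) \<le> L * sqrt (real n) / ln (real n)"
proof (intro eventually_conj)
  show "\<forall>\<^sub>F n in sequentially. 2 \<le> (n::nat)" by (rule eventually_ge_at_top)
  show "\<forall>\<^sub>F n in sequentially. 2 \<le> real n powr (1 / 4)" by real_asymp
  show "\<forall>\<^sub>F n in sequentially. 32 * ln (real n) \<le> real n powr (1 / 8)" by real_asymp
  show "\<forall>\<^sub>F n in sequentially. real n powr (1 / 3) \<le> L * sqrt (real n) / ln (real n)"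
    using L by real_asymp
qed

text \<open>A bound for a single \<open>n\<close>: outside three bad events the chromatic number
  lies between \<open>k\<close> and \<open>k\<close> plus the colours spent on the deleted vertices.
  In \<open>C\<close>, 48 = 12 * 4 combines the extraction constant with the
  \<open>4 * w * sqrt n\<close> deletions, and the 1 pays for the leftover.\<close>

lemma gnp_chromatic_number_concentration:
  fixes p w L :: real
  defines "C \<equiv> 48 * (1 + ln 16 / L) + 1"
  assumes n: "2 \<le> n" "2 \<le> real n powr (1 / 4)" "32 * ln (real n) \<le> real n powr (1 / 8)"
      "real n powr (1 / 3) \<le> L * sqrt (real n) / ln (real n)"
    and p: "0 \<le> p" "p < 1" "L \<le> ln (1 / (1 - p))" and L: "0 < L" and w: "1 \<le> w"
  shows "\<exists>a. measure_pmf.prob (gnp n p)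
      {E. a \<le> real (chromatic_number n E) \<and> real (chromatic_number n E) \<le>
          a + of_int \<lfloor>C * w * sqrt (real n) / log (1 / (1 - p)) (real n)\<rfloor>}
    \<ge> 1 - 2 / w\<^sup>2 - (exp (1 / real n) - 1)"
proof -
  define q where "q = 1 - p"
  define b where "b = log (1 / q) (real n)"
  define s where "s = w * sqrt (real n)"
  define P where "P = measure_pmf.prob (gnp n p)"
  define Z where "Z k = {E. deletion_number n E k = 0}" for k
  define k where "k = (LEAST k. 1 / w\<^sup>2 \<le> P (Z k))"
  have lnn: "ln (real n) > 0" using n(1) by simp
  have lq: "ln (1 / q) > 0" unfolding q_def using L p(3) by (rule less_le_trans)
  have q: "q > 0" using p by (simp add: q_def)
  have b: "b = ln (real n) / ln (1 / q)" by (simp add: b_def log_def)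
  have b0: "b > 0" using lnn lq by (simp add: b)
  have s0: "s > 0" using w n(1) by (simp add: s_def)
  have "Z n = UNIV"
    using colourable_card[of "{..<n}"] by (auto simp: Z_def deletion_number_eq_0_iff)
  hence "1 / w\<^sup>2 \<le> P (Z n)" using w by (simp add: P_def field_simps)
  hence k: "1 / w\<^sup>2 \<le> P (Z k)" unfolding k_def by (rule LeastI)
  \<comment> \<open>For \<open>k = 0\<close> truncated subtraction would turn
    \<open>Z (k - 1)\<close> into the likely event \<open>Z k\<close>.\<close>
  define B1 where "B1 = (if k = 0 then {} else Z (k - 1))"
  define B2 where "B2 = {E. real (deletion_number n E k) \<ge> 4 * s}"
  define B3 where "B3 = (if b < 8 then {} else {E. \<not> nonneighbour_rich n E (real n powr (1 / 4)) (q / 16)})"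
  define G where "G = {E. real k \<le> real (chromatic_number n E) \<and> real (chromatic_number n E) \<le>
    real k + of_int \<lfloor>C * w * sqrt (real n) / b\<rfloor>}"
  have B1: "P B1 \<le> 1 / w\<^sup>2"
  proof (cases "k = 0")
    case False
    hence "\<not> 1 / w\<^sup>2 \<le> P (Z (k - 1))" using not_less_Least[of "k - 1" "\<lambda>k. 1 / w\<^sup>2 \<le> P (Z k)"]
      by (simp add: k_def)
    thus ?thesis using False by (simp add: B1_def)
  qed (simp add: B1_def P_def)
  have B2: "P B2 \<le> 1 / w\<^sup>2"
    using deletion_number_small[of n w p k] k n(1) w by (simp add: P_def Z_def B2_def s_def mult.assoc)
  have B3: "P B3 \<le> exp (1 / real n) - 1"
  proof (cases "b < 8")
    case True
    thus ?thesis by (simp add: B3_def P_def)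
  next
    case False
    \<comment> \<open>The bound \<open>b \<ge> 8\<close> says
      \<open>q \<ge> n powr (- (1/8))\<close>, whence
      \<open>q * n powr (1/4) \<ge> n powr (1/8)\<close>.\<close>
    hence "ln (1 / q) \<le> ln (real n) / 8" using lq by (simp add: b field_simps)
    hence "- (ln (real n) / 8) \<le> ln q" using q by (simp add: ln_div)
    hence "exp (- (ln (real n) / 8)) \<le> q" using q by (metis exp_le_cancel_iff exp_ln)
    hence "real n powr (- (1 / 8)) \<le> q" using n(1) by (simp add: powr_def)
    hence "real n powr (- (1 / 8)) * real n powr (1 / 4) \<le> q * real n powr (1 / 4)"
      by (rule mult_right_mono) simp
    hence "32 * ln (real n) \<le> q * real n powr (1 / 4)"
      using n(3) by (simp add: powr_add[symmetric])
    hence "P {E. \<not> nonneighbour_rich n E (real n powr (1 / 4)) (q / 16)} \<le> exp (1 / real n) - 1"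
      unfolding P_def q_def using p n by (intro prob_not_nonneighbour_rich_le) auto
    thus ?thesis using False by (simp add: B3_def)
  qed
  have good: "E \<in> G" if E: "E \<subseteq> all_edges n" "E \<notin> B1" "E \<notin> B2" "E \<notin> B3" for E
  proof -
    have lower: "k \<le> chromatic_number n E"
    proof (rule ccontr)
      assume "\<not> k \<le> chromatic_number n E"
      hence "chromatic_number n E \<le> k - 1" "k \<noteq> 0" by auto
      hence "E \<in> B1"
        using chromatic_number_le_iff[OF E(1)] by (simp add: B1_def Z_def deletion_number_eq_0_iff)
      thus False using E(2) by simp
    qed
    obtain S where S: "S \<subseteq> {..<n}" "card S = deletion_number n E k" "colourable ({..<n} - S) E k"
      by (rule deletion_number_obtain)
    have cS: "real (card S) \<le> 4 * s" using E(3) S(2) by (simp add: B2_def)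
    define D where "D = 1 + ln 16 / L"
    have D1: "1 \<le> D" using L by (simp add: D_def)
    have C_D: "C = 48 * D + 1" by (simp add: C_def D_def)
    have "\<exists>K. colourable S E K \<and> real K \<le> C * s / b"
    proof (cases "b < 8")
      case True
      have "b * real (card S) \<le> 8 * (4 * s)" using True b0 cS s0 by (intro mult_mono) auto
      also have "\<dots> = 32 * s" by simp
      also have "32 \<le> C" using D1 by (simp add: C_D)
      hence "32 * s \<le> C * s" using s0 by (intro mult_right_mono) auto
      finally have "real (card S) \<le> C * s / b" using b0 by (simp add: field_simps)
      thus ?thesis using colourable_card[of S E] finite_subset[OF S(1)] by auto
    next
      case False
      hence "nonneighbour_rich n E (real n powr (1 / 4)) (q / 16)" using E(4) by (simp add: B3_def)
      then obtain K where K: "colourable S E K"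
        "real K \<le> 12 * D * real (card S) / b + real n powr (1 / 3)"
        using colourable_nonneighbour_rich[OF n(1) q _ L _ S(1)] p(3) unfolding b_def q_def D_def by blast
      note K(2)
      also have "12 * D * real (card S) / b \<le> 12 * D * (4 * s) / b"
        using cS D1 b0 by (intro divide_right_mono mult_left_mono) auto
      \<comment> \<open>Together with \<open>L \<le> ln (1 / q)\<close> and
        \<open>w \<ge> 1\<close>, the leftover costs at most \<open>s / b\<close>.\<close>
      also have "real n powr (1 / 3) \<le> L * sqrt (real n) / ln (real n)" by (rule n(4))
      also have "\<dots> \<le> ln (1 / q) * s / ln (real n)"
        using p(3) w lnn lq unfolding s_def q_def
        by (intro divide_right_mono mult_mono) (auto simp: mult_le_cancel_right1)
      also have "\<dots> = s / b" by (simp add: b)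
      finally have "real K \<le> C * s / b" by (simp add: C_D add_divide_distrib algebra_simps)
      thus ?thesis using K(1) by blast
    qed
    then obtain K where K: "colourable S E K" "real K \<le> C * s / b" by blast
    have "({..<n} - S) \<union> S = {..<n}" using S(1) by blast
    hence "chromatic_number n E \<le> k + K"
      using colourable_union[OF S(3) K(1)] chromatic_number_le_iff[OF E(1)] by simp
    \<comment> \<open>As \<open>K\<close> is an integer, its bound passes to the floor.\<close>
    moreover have "int K \<le> \<lfloor>C * s / b\<rfloor>" using K(2) by (simp add: le_floor_iff)
    ultimately show ?thesis using lower by (simp add: G_def s_def mult.assoc)
  qed
  have "1 = P UNIV" by (simp add: P_def)
  also have "\<dots> \<le> P (G \<union> B1 \<union> B2 \<union> B3)"
    unfolding P_def
  proof (rule measure_pmf.finite_measure_mono_AE)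
    show "AE E in gnp n p. E \<in> UNIV \<longrightarrow> E \<in> G \<union> B1 \<union> B2 \<union> B3"
      unfolding AE_measure_pmf_iff using good set_gnp_subset by blast
  qed simp
  also have "\<dots> \<le> P G + P B1 + P B2 + P B3"
    unfolding P_def
    by (intro order_trans[OF measure_Un_le] add_mono) auto
  finally have "P G \<ge> 1 - 2 / w\<^sup>2 - (exp (1 / real n) - 1)" using B1 B2 B3 by simp
  thus ?thesis unfolding P_def G_def b_def q_def by blast
qed

theorem theorem4:
  fixes \<gamma> :: real
  assumes "0 < \<gamma>" and "\<gamma> < 1"
  shows "\<exists>C > (0::real). \<forall>(\<omega> :: nat \<Rightarrow> real) (p :: nat \<Rightarrow> real).
           filterlim \<omega> at_top sequentially \<longrightarrow>
           (\<forall>n. \<gamma> \<le> p n \<and> p n < 1) \<longrightarrow>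
           (\<exists>a :: nat \<Rightarrow> real.
              (\<lambda>n. measure_pmf.prob (gnp n (p n))
                 {E. a n \<le> real (chromatic_number n E) \<and>
                     real (chromatic_number n E) \<le> a n +
                       of_int \<lfloor>C * \<omega> n * sqrt (real n) / log (1 / (1 - p n)) (real n)\<rfloor>})
              \<longlonglongrightarrow> 1)"
proof -
  \<comment> \<open>\<open>L\<close> bounds \<open>ln (1 / (1 - p n))\<close> from below for every
    \<open>n\<close>, so \<open>C\<close> depends only on \<gamma>.\<close>
  define L where "L = ln (1 / (1 - \<gamma>))"
  define C where "C = 48 * (1 + ln 16 / L) + 1"
  have L: "L > 0" using assms by (simp add: L_def)
  have "C > 0" unfolding C_def using L by (intro add_pos_pos mult_pos_pos divide_pos_pos) auto
  moreover have "\<exists>a :: nat \<Rightarrow> real.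
      (\<lambda>n. measure_pmf.prob (gnp n (p n))
         {E. a n \<le> real (chromatic_number n E) \<and> real (chromatic_number n E) \<le> a n +
               of_int \<lfloor>C * \<omega> n * sqrt (real n) / log (1 / (1 - p n)) (real n)\<rfloor>}) \<longlonglongrightarrow> 1"
    if \<omega>: "filterlim \<omega> at_top sequentially" and p: "\<forall>n. \<gamma> \<le> p n \<and> p n < 1"
    for \<omega> p :: "nat \<Rightarrow> real"
  proof -
    define Pr where "Pr n a = measure_pmf.prob (gnp n (p n))
         {E. a \<le> real (chromatic_number n E) \<and> real (chromatic_number n E) \<le> a +
               of_int \<lfloor>C * \<omega> n * sqrt (real n) / log (1 / (1 - p n)) (real n)\<rfloor>}" for n and a :: real
    define err where "err n = 2 / (\<omega> n)\<^sup>2 + (exp (1 / real n) - 1)" for n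
    \<comment> \<open>A suitable left endpoint exists for all large \<open>n\<close>; the values at
      other \<open>n\<close> do not affect the limit.\<close>
    define a where "a n = (SOME a. 1 - err n \<le> Pr n a)" for n
    have "\<forall>\<^sub>F n in sequentially. 1 \<le> \<omega> n"
      using \<omega> by (auto simp: filterlim_at_top)
    hence lower: "\<forall>\<^sub>F n in sequentially. 1 - err n \<le> Pr n (a n)"
      using eventually_large[OF L]
    proof eventually_elim
      case (elim n)
      have "L \<le> ln (1 / (1 - p n))"
        unfolding L_def using p assms by (intro ln_mono divide_left_mono) auto
      moreover have "0 \<le> p n" "p n < 1" using p assms by (auto intro: order_trans[of 0 \<gamma>])
      ultimately have "\<exists>a. 1 - err n \<le> Pr n a"
        using gnp_chromatic_number_concentration[of n L "p n" "\<omega> n"] elim L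
        unfolding Pr_def err_def C_def diff_diff_eq by blast
      thus ?case unfolding a_def by (rule someI_ex)
    qed
    have "(\<lambda>n. 2 / (\<omega> n)\<^sup>2) \<longlonglongrightarrow> 0"
      using \<omega> by (intro tendsto_divide_0[OF tendsto_const] filterlim_at_top_imp_at_infinity
        filterlim_pow_at_top) auto
    moreover have "(\<lambda>n. exp (1 / real n) - 1) \<longlonglongrightarrow> 0" by real_asymp
    ultimately have "err \<longlonglongrightarrow> 0 + 0" unfolding err_def[abs_def] by (rule tendsto_add)
    hence "(\<lambda>n. 1 - err n) \<longlonglongrightarrow> 1 - 0" by (intro tendsto_diff tendsto_const) simp
    hence "(\<lambda>n. Pr n (a n)) \<longlonglongrightarrow> 1"
      by (intro tendsto_sandwich[OF lower, of "\<lambda>_. 1"]) (auto simp: Pr_def)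
    thus ?thesis unfolding Pr_def by blast
  qed
  ultimately show ?thesis by blast
qed

end
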